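(* Let $r\ge 1$, let $U^{(1)},\dots,U^{(r)}$ be unitary matrices of sizes $n_1\times n_1,\dots,n_r\times n_r$ with all $n_k>1$, and let $U=U^{(1)}\otimes\cdots\otimes U^{(r)}$. The generalized defect of $U$ satisfies the lower bound $\mathbf{D}(U)\ge L$, where $$L=(n_1\cdots n_r)^2-\sum_{p=0}^{r-1}\ \sum_{1\le k_1<\dots<k_p\le r}\left(n_{k_1}\cdots n_{k_p}\Big(\prod_{l\in\{1,\dots,r\}\setminus\{k_1,\dots,k_p\}}n_l-2^{\,\sharp_2(\{1,\dots,r\}\setminus\{k_1,\dots,k_p\})-1}\Big)\prod_{l\in\{1,\dots,r\}\setminus\{k_1,\dots,k_p\}}(n_l-1)\right)$$ (for $p=0$ the inner sum consists of the single term with $\{k_1,\dots,k_p\}=\emptyset$ and empty product $n_{k_1}\cdots n_{k_p}=1$). This lower bound $L$ is equal to: a) $\displaystyle\prod_{l=1}^r(2n_l-1)$, if all $n_k>2$; b) $\displaystyle\Big(\prod_{l\in\{1,\dots,r\},\,n_l>2}(2n_l-1)\Big)\cdot 2^{x-1}\,(2^{x}+1)$, if there is at least one $2$ in the sequence $(n_1,\dots,n_r)$, where $x=\sharp_2(\{1,\dots,r\})$ is the number of $2$'s in this sequence.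
   Context: For a nonempty subset $\mathcal{A}=\{l_1,\dots,l_s\}\subseteq\{1,\dots,r\}$, $\sharp_2(\mathcal{A})$ denotes the number of $2$'s in the sequence $(n_{l_1},\dots,n_{l_s})$ if there are any, and $\sharp_2(\mathcal{A})=1$ otherwise. For a unitary $N\times N$ matrix $U$ and $1\le i<j\le N$ let $M_U^{(i,j)}$ be the complex $N\times N$ matrix whose $i$-th row has entries $U_{i,c}\overline{U_{j,c}}$ ($c=1,\dots,N$), whose $j$-th row has entries $-U_{i,c}\overline{U_{j,c}}$, and whose other rows are zero. Let $A_U^{(i,j)}$ and $S_U^{(i,j)}$ be its entrywise real and imaginary parts. Let $\mathbb{M}_U$ be the real linear span, inside the space of real $N\times N$ matrices, of all $A_U^{(i,j)},S_U^{(i,j)}$, $1\le i<j\le N$. The generalized defect of $U$ is $\mathbf{D}(U)=N^2-\dim_{\mathbb{R}}\mathbb{M}_U$. *)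

theory Defs
  imports "Jordan_Normal_Form.VS_Connect" "Jordan_Normal_Form.Schur_Decomposition"
begin

definition unitary_mat :: "nat \<Rightarrow> complex mat \<Rightarrow> bool" where
  "unitary_mat N U \<longleftrightarrow>
     U \<in> carrier_mat N N \<and> U * mat_adjoint U = 1\<^sub>m N \<and> mat_adjoint U * U = 1\<^sub>m N"

definition kronecker :: "complex mat \<Rightarrow> complex mat \<Rightarrow> complex mat" where
  "kronecker A B = mat (dim_row A * dim_row B) (dim_col A * dim_col B)
     (\<lambda>(i, j). A $$ (i div dim_row B, j div dim_col B) * B $$ (i mod dim_row B, j mod dim_col B))"

definition kronecker_list :: "complex mat list \<Rightarrow> complex mat" where
  "kronecker_list As = foldr kronecker As (1\<^sub>m 1)"

text \<open>The initial value of the fold is neutral, so a one-element list yields its element.\<close>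

lemma kronecker_one_right: "kronecker A (1\<^sub>m 1) = A"
  by (rule eq_matI) (auto simp: kronecker_def)

text \<open>Matrices are indexed from 0: rows \<open>i < j\<close> range over \<open>{0..<N}\<close> instead of \<open>{1..N}\<close>.\<close>

definition defect_mat :: "complex mat \<Rightarrow> nat \<Rightarrow> nat \<Rightarrow> complex mat" where
  "defect_mat U i j = mat (dim_row U) (dim_row U)
     (\<lambda>(k, c). if k = i then U $$ (i, c) * cnj (U $$ (j, c))
               else if k = j then - (U $$ (i, c) * cnj (U $$ (j, c)))
               else 0)"

definition defect_A :: "complex mat \<Rightarrow> nat \<Rightarrow> nat \<Rightarrow> real mat" where
  "defect_A U i j = map_mat Re (defect_mat U i j)"

definition defect_S :: "complex mat \<Rightarrow> nat \<Rightarrow> nat \<Rightarrow> real mat" where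
  "defect_S U i j = map_mat Im (defect_mat U i j)"

definition defect_space :: "complex mat \<Rightarrow> real mat set" where
  "defect_space U = LinearCombinations.module.span class_ring
     (module_mat TYPE(real) (dim_row U) (dim_row U))
     ({defect_A U i j | i j. i < j \<and> j < dim_row U} \<union>
      {defect_S U i j | i j. i < j \<and> j < dim_row U})"

definition generalized_defect :: "complex mat \<Rightarrow> int" where
  "generalized_defect U = int ((dim_row U)\<^sup>2) -
     int (vectorspace.dim class_ring
       (module_mat TYPE(real) (dim_row U) (dim_row U)\<lparr>carrier := defect_space U\<rparr>))"

definition sharp2 :: "(nat \<Rightarrow> nat) \<Rightarrow> nat set \<Rightarrow> nat" where
  "sharp2 n A = (if \<exists>l\<in>A. n l = 2 then card {l \<in> A. n l = 2} else 1)"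

text \<open>An increasing sequence \<open>k\<^sub>1 < \<dots> < k\<^sub>p\<close> is encoded by the set \<open>K\<close> of its members.
  The exponent subtraction on naturals never truncates, as \<open>sharp2\<close> is at least 1
  on finite sets.\<close>

definition defect_lower_bound :: "nat \<Rightarrow> (nat \<Rightarrow> nat) \<Rightarrow> int" where
  "defect_lower_bound r n = (\<Prod>l\<in>{1..r}. int (n l))\<^sup>2 -
     (\<Sum>p\<in>{0..r - 1}. \<Sum>K\<in>{K. K \<subseteq> {1..r} \<and> card K = p}.
        (\<Prod>k\<in>K. int (n k)) *
        ((\<Prod>l\<in>{1..r} - K. int (n l)) - 2 ^ (sharp2 n ({1..r} - K) - 1)) *
        (\<Prod>l\<in>{1..r} - K. (int (n l) - 1)))"

end

theory Submission
  imports Defs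
begin

text \<open>The real span of the matrices \<open>A\<^sub>U\<close> and \<open>S\<^sub>U\<close> is the annihilator, under the entrywise
  inner product, of the space of real matrices \<open>B\<close> with
  \<open>\<Sum>\<^sub>c (B\<^sub>i\<^sub>c - B\<^sub>j\<^sub>c) U\<^sub>i\<^sub>c cnj U\<^sub>j\<^sub>c = 0\<close> for all rows \<open>i\<close>, \<open>j\<close>. So the defect of \<open>U\<close> is the
  dimension of that space of \<^emph>\<open>phase variations\<close> (the rates at which the phases of the entries of
  \<open>U\<close> may move while its rows stay orthonormal to first order), and a lower bound is a supply of
  linearly independent phase variations; \<open>generalized_defect_ge\<close> is this step.

  Three observations supply them. Products of phase variations of two matrices are phase variations
  of their Kronecker product, so the number of independent ones is supermultiplicative
  (\<open>defect_at_least_tensor\<close>). Every unitary matrix of size \<open>n\<close> has the trivial variations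
  \<open>B\<^sub>i\<^sub>c = a\<^sub>i + b\<^sub>c\<close>, which span dimension \<open>2 n - 1\<close> (\<open>unitary_defect_at_least\<close>). For size 2 one does
  better than multiplying the resulting 3's: in a Kronecker product of \<open>x\<close> unitary matrices of size 2,
  the products \<open>U\<^sub>i\<^sub>c cnj U\<^sub>j\<^sub>c\<close> all lie, for fixed rows \<open>i\<close>, \<open>j\<close>, on one real line through the origin.
  Each pair of rows then imposes one real equation on \<open>B\<close> instead of two, and at least
  \<open>k\<^sup>2 - k (k - 1) / 2 = k (k + 1) / 2\<close> dimensions survive, where \<open>k = 2 ^ x\<close>
  (\<open>aligned_rows_defect_at_least\<close>).

  Reordering the factors so that those of size 2 stand together (\<open>kronecker_list_regroup\<close>) gives
  \<open>D(U) \<ge> Q \<cdot> 2 ^ x (2 ^ x + 1) / 2\<close>, with \<open>Q\<close> the product of the \<open>2 n\<^sub>l - 1\<close> over \<open>n\<^sub>l \<noteq> 2\<close>. The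
  expression \<open>L\<close> equals the same number: adding the vanishing term for the full set
  \<open>{1, \<dots>, r}\<close> makes it a sum over all subsets \<open>{k\<^sub>1, \<dots>, k\<^sub>p}\<close>, and since
  \<open>2 \<cdot> 2 ^ (\<sharp>\<^sub>2(S) - 1)\<close> is a sum of two multiplicative functions of \<open>S\<close>, the sum factors into
  products over \<open>l\<close> (\<open>twice_defect_lower_bound\<close>). The closed forms a) and b) are the cases \<open>x = 0\<close>
  and \<open>x > 0\<close>.\<close>

section \<open>Homogeneous linear systems\<close>

text \<open>Gaussian elimination, one equation at a time: an equation that involves some unknown is used to
  eliminate that unknown, which removes one equation and one unknown.\<close>

lemma underdetermined_system_nontrivial:
  fixes a :: "'v \<Rightarrow> 'e \<Rightarrow> real"
  assumes "finite E" "finite V" "card E < card V"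
  shows "\<exists>x. (\<exists>v\<in>V. x v \<noteq> 0) \<and> (\<forall>e\<in>E. (\<Sum>v\<in>V. x v * a v e) = 0)"
  using assms
proof (induction E arbitrary: V a rule: finite_induct)
  case empty
  then have "V \<noteq> {}" by auto
  then show ?case by (intro exI[of _ "\<lambda>_. 1"]) auto
next
  case (insert e E)
  show ?case
  proof (cases "\<forall>v\<in>V. a v e = 0")
    case True
    have "card E < card V" using insert.prems insert.hyps by simp
    from insert.IH[OF insert.prems(1) this, of a] True show ?thesis by auto
  next
    case False
    then obtain w where w: "w \<in> V" "a w e \<noteq> 0" by auto
    \<comment> \<open>the coefficients after subtracting the multiple of equation \<open>e\<close> that cancels the unknown \<open>w\<close>\<close>
    define a' where "a' v f = a v f - a v e / a w e * a w f" for v f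
    have "card E < card (V - {w})" using insert.prems insert.hyps w by simp
    from insert.IH[OF _ this, of a'] insert.prems obtain x where x:
      "\<exists>v\<in>V-{w}. x v \<noteq> 0" "\<And>f. f \<in> E \<Longrightarrow> (\<Sum>v\<in>V-{w}. x v * a' v f) = 0" by auto
    define t where "t = - (\<Sum>v\<in>V-{w}. x v * a v e) / a w e"
    define y where "y = x(w := t)"
    have s: "(\<Sum>v\<in>V. y v * a v f) = t * a w f + (\<Sum>v\<in>V-{w}. x v * a v f)" for f
      using w insert.prems by (subst sum.remove[of V w]) (auto simp: y_def intro!: sum.cong)
    have "(\<Sum>v\<in>V. y v * a v e) = 0" unfolding s t_def using w by simp
    moreover have "(\<Sum>v\<in>V. y v * a v f) = 0" if "f \<in> E" for f
    proof -
      have "(\<Sum>v\<in>V-{w}. x v * a' v f)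
          = (\<Sum>v\<in>V-{w}. x v * a v f) - (\<Sum>v\<in>V-{w}. x v * a v e) / a w e * a w f"
        unfolding a'_def sum_divide_distrib sum_distrib_right sum_subtractf[symmetric]
        by (rule sum.cong) (auto simp: algebra_simps)
      then show ?thesis using x(2)[OF that] unfolding s t_def by simp
    qed
    moreover have "\<exists>v\<in>V. y v \<noteq> 0" using x(1) by (auto simp: y_def)
    ultimately show ?thesis by (intro exI[of _ y]) auto
  qed
qed

definition independent_on :: "'x set \<Rightarrow> 'k set \<Rightarrow> ('k \<Rightarrow> 'x \<Rightarrow> real) \<Rightarrow> bool" where
  "independent_on X A F \<longleftrightarrow>
     (\<forall>z. (\<forall>x\<in>X. (\<Sum>a\<in>A. z a * F a x) = 0) \<longrightarrow> (\<forall>a\<in>A. z a = 0))"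

text \<open>The solutions are produced one after another. Each new one is required to be orthogonal to its
  predecessors, which costs one further equation per predecessor and makes independence automatic.\<close>

lemma solution_space_dimension:
  fixes g :: "'e \<Rightarrow> 'x \<Rightarrow> real"
  assumes "finite X" "finite E" "card E + d \<le> card X"
  shows "\<exists>F. (\<forall>a\<in>{..<d}. \<forall>e\<in>E. (\<Sum>x\<in>X. F a x * g e x) = 0)
      \<and> independent_on X {..<d} (F :: nat \<Rightarrow> 'x \<Rightarrow> real)"
  using assms(3)
proof (induction d)
  case 0
  show ?case by (auto simp: independent_on_def)
next
  case (Suc d)
  then obtain F :: "nat \<Rightarrow> 'x \<Rightarrow> real" where
    F: "\<And>a e. a < d \<Longrightarrow> e \<in> E \<Longrightarrow> (\<Sum>x\<in>X. F a x * g e x) = 0" and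
    indep: "independent_on X {..<d} F" by auto
  define h where "h x q = (case q of Inl e \<Rightarrow> g e x | Inr a \<Rightarrow> F a x)" for x and q :: "'e + nat"
  have "card (E <+> {..<d}) < card X"
    using Suc.prems assms by (simp add: card_Plus)
  from underdetermined_system_nontrivial[OF _ assms(1) this, of h] assms(2)
  obtain y where y: "\<exists>x\<in>X. y x \<noteq> 0" "\<And>q. q \<in> E <+> {..<d} \<Longrightarrow> (\<Sum>x\<in>X. y x * h x q) = 0"
    by auto
  have yE: "(\<Sum>x\<in>X. y x * g e x) = 0" if "e \<in> E" for e
    using y(2)[of "Inl e"] that by (auto simp: h_def)
  have yF: "(\<Sum>x\<in>X. y x * F a x) = 0" if "a < d" for a
    using y(2)[of "Inr a"] that by (auto simp: h_def)
  have yy: "(\<Sum>x\<in>X. y x * y x) \<noteq> 0"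
    using y(1) assms(1) by (auto simp: sum_nonneg_eq_0_iff)
  define F' where "F' = F(d := y)"
  have split: "(\<Sum>a\<in>{..<Suc d}. z a * F' a x) = (\<Sum>a<d. z a * F a x) + z d * y x" for z x
    by (simp add: F'_def)
  have "independent_on X {..<Suc d} F'"
    unfolding independent_on_def split
  proof (intro allI impI)
    fix z assume z: "\<forall>x\<in>X. (\<Sum>a<d. z a * F a x) + z d * y x = 0"
    have "0 = (\<Sum>x\<in>X. y x * ((\<Sum>a<d. z a * F a x) + z d * y x))"
      using z by simp
    also have "\<dots> = (\<Sum>x\<in>X. \<Sum>a<d. z a * (y x * F a x)) + z d * (\<Sum>x\<in>X. y x * y x)"
      by (simp add: sum.distrib sum_distrib_left algebra_simps)
    also have "(\<Sum>x\<in>X. \<Sum>a<d. z a * (y x * F a x)) = (\<Sum>a<d. z a * (\<Sum>x\<in>X. y x * F a x))"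
      by (subst sum.swap) (simp add: sum_distrib_left)
    also have "\<dots> = 0" using yF by simp
    finally have zd: "z d = 0" using yy by simp
    with z indep have "\<forall>a\<in>{..<d}. z a = 0" unfolding independent_on_def by auto
    with zd show "\<forall>a\<in>{..<Suc d}. z a = 0" by (auto simp: less_Suc_eq)
  qed
  moreover have "\<forall>a\<in>{..<Suc d}. \<forall>e\<in>E. (\<Sum>x\<in>X. F' a x * g e x) = 0"
    using F yE by (auto simp: F'_def less_Suc_eq)
  ultimately show ?case by (intro exI[of _ F'] conjI)
qed

section \<open>Phase variations and their tensor products\<close>

text \<open>To first order in \<open>t\<close>, the matrix with entries \<open>u\<^sub>i\<^sub>c exp(\<i> t B\<^sub>i\<^sub>c)\<close> has the same inner products
  between rows as \<open>u\<close>. Rows and columns are indexed by one arbitrary finite set, so that Kronecker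
  products can be indexed by pairs or by lists.\<close>

definition phase_variation :: "'i set \<Rightarrow> ('i \<Rightarrow> 'i \<Rightarrow> complex) \<Rightarrow> ('i \<times> 'i \<Rightarrow> real) \<Rightarrow> bool" where
  "phase_variation I u B \<longleftrightarrow> (\<forall>i\<in>I. \<forall>j\<in>I.
     (\<Sum>c\<in>I. of_real (B (i, c) - B (j, c)) * (u i c * cnj (u j c))) = 0)"

definition defect_at_least :: "'i set \<Rightarrow> ('i \<Rightarrow> 'i \<Rightarrow> complex) \<Rightarrow> nat \<Rightarrow> bool" where
  "defect_at_least I u d \<longleftrightarrow> (\<exists>F. (\<forall>a\<in>{..<d}. phase_variation I u (F a))
     \<and> independent_on (I \<times> I) {..<d} (F :: nat \<Rightarrow> 'i \<times> 'i \<Rightarrow> real))"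

text \<open>The number of independent variations is witnessed by a family indexed by naturals; a family
  indexed by any finite set serves as well.\<close>

lemma defect_at_leastI:
  fixes A :: "'k set"
  assumes "finite A" "card A = d" "\<And>a. a \<in> A \<Longrightarrow> phase_variation I u (F a)"
    and "independent_on (I \<times> I) A F"
  shows "defect_at_least I u d"
proof -
  obtain h where h: "bij_betw h {..<d} A"
    using ex_bij_betw_nat_finite[OF assms(1)] assms(2) by (auto simp: atLeast0LessThan)
  have "independent_on (I \<times> I) {..<d} (\<lambda>k. F (h k))"
    unfolding independent_on_def
  proof (intro allI impI)
    fix z :: "nat \<Rightarrow> real"
    assume z: "\<forall>x\<in>I \<times> I. (\<Sum>k<d. z k * F (h k) x) = 0"
    define g where "g = the_inv_into {..<d} h"
    have g: "g (h k) = k" if "k < d" for k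
      using h that by (auto simp: g_def bij_betw_def intro!: the_inv_into_f_f)
    have zg: "(\<Sum>a\<in>A. z (g a) * F a x) = 0" if "x \<in> I \<times> I" for x
    proof -
      have "(\<Sum>a\<in>A. z (g a) * F a x) = (\<Sum>k<d. z k * F (h k) x)"
        by (subst sum.reindex_bij_betw[OF h, symmetric]) (auto simp: g intro!: sum.cong)
      then show ?thesis using z that by metis
    qed
    have "z (g a) = 0" if "a \<in> A" for a
      using assms(4)[unfolded independent_on_def, rule_format, of "\<lambda>a. z (g a)"] zg that
      by blast
    moreover have "h k \<in> A" if "k < d" for k
      using bij_betwE[OF h] that by auto
    ultimately show "\<forall>k\<in>{..<d}. z k = 0"
      using g by (metis lessThan_iff)
  qed
  moreover have "\<forall>k\<in>{..<d}. phase_variation I u (F (h k))"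
    using h assms(3) by (auto simp: bij_betw_def)
  ultimately show ?thesis
    unfolding defect_at_least_def by (intro exI[of _ "\<lambda>k. F (h k)"] conjI)
qed

lemma defect_at_least_reindex:
  assumes h: "bij_betw h I J"
    and eq: "\<And>i c. i \<in> I \<Longrightarrow> c \<in> I \<Longrightarrow> u i c = v (h i) (h c)"
    and J: "defect_at_least J v d"
  shows "defect_at_least I u d"
proof -
  obtain F where F: "\<And>a. a < d \<Longrightarrow> phase_variation J v (F a)"
    and ind: "independent_on (J \<times> J) {..<d} (F :: nat \<Rightarrow> 'b \<times> 'b \<Rightarrow> real)"
    using J unfolding defect_at_least_def by auto
  define G where "G a = (\<lambda>(i, c). F a (h i, h c))" for a
  have hI: "h i \<in> J" if "i \<in> I" for i using h that by (auto simp: bij_betw_def)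
  have "phase_variation I u (G a)" if "a < d" for a
    unfolding phase_variation_def
  proof (intro ballI)
    fix i j assume ij: "i \<in> I" "j \<in> I"
    have "(\<Sum>c\<in>I. of_real (G a (i, c) - G a (j, c)) * (u i c * cnj (u j c)))
        = (\<Sum>c\<in>J. of_real (F a (h i, c) - F a (h j, c)) * (v (h i) c * cnj (v (h j) c)))"
      by (subst sum.reindex_bij_betw[OF h, symmetric]) (auto simp: G_def eq ij intro!: sum.cong)
    then show "(\<Sum>c\<in>I. of_real (G a (i, c) - G a (j, c)) * (u i c * cnj (u j c))) = 0"
      using F[OF that] ij hI by (simp add: phase_variation_def)
  qed
  moreover have "independent_on (I \<times> I) {..<d} G"
    unfolding independent_on_def
  proof (intro allI impI)
    fix z assume z: "\<forall>x\<in>I \<times> I. (\<Sum>a<d. z a * G a x) = 0"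
    have "(\<Sum>a<d. z a * F a x) = 0" if x: "x \<in> J \<times> J" for x
    proof -
      obtain i c where "x = (h i, h c)" "i \<in> I" "c \<in> I"
        using x h by (auto simp: bij_betw_def)
      then show ?thesis using z by (auto simp: G_def)
    qed
    then show "\<forall>a\<in>{..<d}. z a = 0" using ind by (auto simp: independent_on_def)
  qed
  ultimately show ?thesis
    unfolding defect_at_least_def by (intro exI[of _ G] conjI) auto
qed

text \<open>For a Kronecker product, the sum of \<open>B\<^sub>i\<^sub>c u\<^sub>i\<^sub>c cnj u\<^sub>j\<^sub>c\<close> over \<open>c\<close> factors when \<open>B\<close> does. Being a phase
  variation means that this sum is unchanged when \<open>B\<^sub>i\<^sub>c\<close> is replaced by \<open>B\<^sub>j\<^sub>c\<close>, and this property
  passes from the factors to the product.\<close>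

lemma defect_at_least_tensor:
  assumes "finite I" "finite J" and "defect_at_least I u d" "defect_at_least J v e"
  shows "defect_at_least (I \<times> J) (\<lambda>p q. u (fst p) (fst q) * v (snd p) (snd q)) (d * e)"
proof -
  obtain F where F: "\<And>a. a < d \<Longrightarrow> phase_variation I u (F a)"
    and indF: "independent_on (I \<times> I) {..<d} (F :: nat \<Rightarrow> 'a \<times> 'a \<Rightarrow> real)"
    using assms unfolding defect_at_least_def by auto
  obtain G where G: "\<And>a. a < e \<Longrightarrow> phase_variation J v (G a)"
    and indG: "independent_on (J \<times> J) {..<e} (G :: nat \<Rightarrow> 'b \<times> 'b \<Rightarrow> real)"
    using assms unfolding defect_at_least_def by auto
  define H where "H k = (\<lambda>(p, q). F (fst k) (fst p, fst q) * G (snd k) (snd p, snd q))"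
    for k :: "nat \<times> nat"
  let ?w = "\<lambda>p q. u (fst p) (fst q) * v (snd p) (snd q)"
  have "phase_variation (I \<times> J) ?w (H k)" if k: "k \<in> {..<d} \<times> {..<e}" for k
    unfolding phase_variation_def
  proof (intro ballI)
    fix p q assume pq: "p \<in> I \<times> J" "q \<in> I \<times> J"
    obtain i i' j j' where ij: "p = (i, i')" "q = (j, j')" by (cases p, cases q)
    let ?f = "\<lambda>s c. of_real (F (fst k) (s, c)) * (u i c * cnj (u j c))"
    let ?g = "\<lambda>s c. of_real (G (snd k) (s, c)) * (v i' c * cnj (v j' c))"
    have prod: "(\<Sum>x\<in>I \<times> J. ?f s (fst x) * ?g s' (snd x)) = (\<Sum>c\<in>I. ?f s c) * (\<Sum>c\<in>J. ?g s' c)"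
      for s s' unfolding sum_product by (simp add: sum.cartesian_product case_prod_unfold)
    have "(\<Sum>c\<in>I. of_real (F (fst k) (i, c) - F (fst k) (j, c)) * (u i c * cnj (u j c))) = 0"
      using F[of "fst k", unfolded phase_variation_def] k pq ij by auto
    then have f: "(\<Sum>c\<in>I. ?f i c) = (\<Sum>c\<in>I. ?f j c)"
      by (simp add: left_diff_distrib sum_subtractf)
    have "(\<Sum>c\<in>J. of_real (G (snd k) (i', c) - G (snd k) (j', c)) * (v i' c * cnj (v j' c))) = 0"
      using G[of "snd k", unfolded phase_variation_def] k pq ij by auto
    then have g: "(\<Sum>c\<in>J. ?g i' c) = (\<Sum>c\<in>J. ?g j' c)"
      by (simp add: left_diff_distrib sum_subtractf)
    have "(\<Sum>x\<in>I \<times> J. of_real (H k (p, x) - H k (q, x)) * (?w p x * cnj (?w q x)))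
        = (\<Sum>x\<in>I \<times> J. ?f i (fst x) * ?g i' (snd x)) - (\<Sum>x\<in>I \<times> J. ?f j (fst x) * ?g j' (snd x))"
      unfolding sum_subtractf[symmetric]
      by (rule sum.cong) (auto simp: H_def ij algebra_simps)
    also have "\<dots> = 0" unfolding prod f g by simp
    finally show "(\<Sum>x\<in>I \<times> J. of_real (H k (p, x) - H k (q, x)) * (?w p x * cnj (?w q x))) = 0" .
  qed
  moreover have "independent_on ((I \<times> J) \<times> (I \<times> J)) ({..<d} \<times> {..<e}) H"
    unfolding independent_on_def
  proof (intro allI impI)
    fix z :: "nat \<times> nat \<Rightarrow> real"
    assume z: "\<forall>x\<in>(I \<times> J) \<times> (I \<times> J). (\<Sum>k\<in>{..<d} \<times> {..<e}. z k * H k x) = 0"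
    have "(\<Sum>b<e. z (a, b) * G b y) = 0" if y: "y \<in> J \<times> J" and a: "a < d" for y a
    proof -
      have "(\<Sum>a<d. (\<Sum>b<e. z (a, b) * G b y) * F a x) = 0" if x: "x \<in> I \<times> I" for x
      proof -
        have "(\<Sum>a<d. (\<Sum>b<e. z (a, b) * G b y) * F a x)
            = (\<Sum>k\<in>{..<d} \<times> {..<e}. z k * H k ((fst x, fst y), (snd x, snd y)))"
          unfolding sum_distrib_right sum.cartesian_product
          by (rule sum.cong) (auto simp: H_def)
        also have "\<dots> = 0" using z x y by (auto simp: mem_Times_iff)
        finally show ?thesis .
      qed
      then show ?thesis
        using indF[unfolded independent_on_def, rule_format, of "\<lambda>a. \<Sum>b<e. z (a, b) * G b y"] a
        by blast
    qed
    then have "z (a, b) = 0" if "a < d" "b < e" for a b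
      using indG[unfolded independent_on_def, rule_format, of "\<lambda>b. z (a, b)"] that by blast
    then show "\<forall>k\<in>{..<d} \<times> {..<e}. z k = 0" by auto
  qed
  ultimately show ?thesis
    by (intro defect_at_leastI[of "{..<d} \<times> {..<e}" _ _ _ H]) (auto simp: card_cartesian_product)
qed

section \<open>The defect as a dimension count\<close>

lemma index_lincomb_mat:
  fixes a :: "real mat \<Rightarrow> real"
  assumes "finite A" "A \<subseteq> carrier_mat nr nc" "i < nr" "j < nc"
  shows "module.lincomb (module_mat TYPE(real) nr nc) a A $$ (i, j) = (\<Sum>m\<in>A. a m * m $$ (i, j))"
proof -
  interpret V: vectorspace class_ring "module_mat TYPE(real) nr nc" by (rule matrix_vs)
  show ?thesis using assms(1,2)
  proof (induction A rule: finite_induct)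
    case empty
    show ?case using assms(3,4) by (simp add: V.lincomb_def module_mat_simps)
  next
    case (insert m A)
    have "V.lincomb a (insert m A) = a m \<cdot>\<^sub>m m + V.lincomb a A"
      unfolding V.lincomb_def using insert.hyps insert.prems
      by (subst V.finsum_insert) (auto simp: module_mat_simps)
    moreover have "V.lincomb a A \<in> carrier_mat nr nc"
      using V.lincomb_closed[of A a] insert.hyps insert.prems
      by (auto simp: module_mat_simps class_ring_simps)
    ultimately show ?case using insert assms(3,4) by auto
  qed
qed

text \<open>This allows orthogonality to be checked on a spanning set only.\<close>

lemma submodule_orthogonal:
  fixes B :: "nat \<times> nat \<Rightarrow> real"
  shows "submodule class_ring {m \<in> carrier_mat N N. (\<Sum>x\<in>{..<N} \<times> {..<N}. B x * m $$ x) = 0}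
           (module_mat TYPE(real) N N)"
proof -
  interpret V: vectorspace class_ring "module_mat TYPE(real) N N" by (rule matrix_vs)
  have "(\<Sum>x\<in>{..<N} \<times> {..<N}. B x * (v + w) $$ x) = 0"
    if "v \<in> carrier_mat N N" "w \<in> carrier_mat N N"
      "(\<Sum>x\<in>{..<N} \<times> {..<N}. B x * v $$ x) = 0" "(\<Sum>x\<in>{..<N} \<times> {..<N}. B x * w $$ x) = 0" for v w
  proof -
    have "(\<Sum>x\<in>{..<N} \<times> {..<N}. B x * (v + w) $$ x)
        = (\<Sum>x\<in>{..<N} \<times> {..<N}. B x * v $$ x + B x * w $$ x)"
      using that(1,2) by (intro sum.cong) (auto simp: algebra_simps)
    then show ?thesis using that(3,4) by (simp add: sum.distrib)
  qed
  moreover have "(\<Sum>x\<in>{..<N} \<times> {..<N}. B x * (c \<cdot>\<^sub>m v) $$ x) = 0"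
    if "v \<in> carrier_mat N N" "(\<Sum>x\<in>{..<N} \<times> {..<N}. B x * v $$ x) = 0" for c v
  proof -
    have "(\<Sum>x\<in>{..<N} \<times> {..<N}. B x * (c \<cdot>\<^sub>m v) $$ x)
        = (\<Sum>x\<in>{..<N} \<times> {..<N}. c * (B x * v $$ x))"
      using that(1) by (intro sum.cong) auto
    also have "\<dots> = c * (\<Sum>x\<in>{..<N} \<times> {..<N}. B x * v $$ x)" by (rule sum_distrib_left[symmetric])
    finally show ?thesis using that(2) by simp
  qed
  ultimately show ?thesis
    unfolding submodule_def module_mat_simps class_ring_simps
    by (intro conjI V.module_axioms) (auto simp: sum.neutral)
qed

text \<open>A nontrivial relation between a basis of the span and the family would split into two parts,
  one on each side, that are opposite and orthogonal; so both are zero, against independence.\<close>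

lemma dim_span_mat_le:
  fixes G :: "real mat set" and F :: "nat \<Rightarrow> nat \<times> nat \<Rightarrow> real" and N :: nat
  defines "V \<equiv> module_mat TYPE(real) N N"
  assumes G: "finite G" "G \<subseteq> carrier_mat N N"
    and orth: "\<And>a m. a < d \<Longrightarrow> m \<in> G \<Longrightarrow> (\<Sum>x\<in>{..<N} \<times> {..<N}. F a x * m $$ x) = 0"
    and indep: "independent_on ({..<N} \<times> {..<N}) {..<d} F"
  shows "vectorspace.dim class_ring (V\<lparr>carrier := LinearCombinations.module.span class_ring V G\<rparr>) + d
           \<le> N\<^sup>2"
proof -
  interpret V: vectorspace class_ring V unfolding V_def by (rule matrix_vs)
  let ?X = "{..<N} \<times> {..<N}" and ?W = "V.span G"
  have carrier: "carrier V = carrier_mat N N" by (simp add: V_def module_mat_simps)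
  have GV: "G \<subseteq> carrier V" using G(2) carrier by simp
  have subm: "submodule class_ring ?W V" using V.span_is_submodule[OF GV] .
  interpret W: vectorspace class_ring "V\<lparr>carrier := ?W\<rparr>"
    using V.subspace_is_vs[OF V.span_is_subspace[OF GV]] .
  have GW: "G \<subseteq> ?W" using V.in_own_span[OF GV] .
  have "W.span G = ?W" using V.span_li_not_depend(1)[OF GW subm] .
  then have "W.fin_dim" unfolding W.fin_dim_def using G(1) GW by auto
  then obtain \<beta> where \<beta>: "finite \<beta>" "W.basis \<beta>" using W.finite_basis_exists by blast
  have \<beta>W: "\<beta> \<subseteq> ?W" using \<beta>(2) by (simp add: W.basis_def)
  have \<beta>V: "\<beta> \<subseteq> carrier_mat N N"
    using \<beta>W V.span_is_subset2[OF GV] carrier by auto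
  have li: "V.lin_indpt \<beta>"
    using \<beta>(2) V.span_li_not_depend(2)[OF \<beta>W subm] by (simp add: W.basis_def)
  have orth\<beta>: "(\<Sum>x\<in>?X. F a x * m $$ x) = 0" if "a < d" "m \<in> \<beta>" for a m
  proof -
    have "G \<subseteq> {m \<in> carrier_mat N N. (\<Sum>x\<in>?X. F a x * m $$ x) = 0}"
      using G(2) orth[OF that(1)] by auto
    from V.span_is_subset[OF this submodule_orthogonal[of N "F a", folded V_def]]
    show ?thesis using \<beta>W that(2) by auto
  qed
  have "card \<beta> + d \<le> N\<^sup>2"
  proof (rule ccontr)
    assume "\<not> ?thesis"
    then have lt: "card ?X < card (\<beta> <+> {..<d})"
      using \<beta>(1) by (simp add: card_Plus card_cartesian_product power2_eq_square)
    define h where "h q x = (case q of Inl m \<Rightarrow> m $$ x | Inr a \<Rightarrow> F a x)"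
      for q :: "real mat + nat" and x
    obtain z where z: "\<exists>q\<in>\<beta> <+> {..<d}. z q \<noteq> 0"
      "\<And>x. x \<in> ?X \<Longrightarrow> (\<Sum>q\<in>\<beta> <+> {..<d}. z q * h q x) = 0"
      using underdetermined_system_nontrivial[OF _ _ lt, of h] \<beta>(1) by auto
    define P where "P x = (\<Sum>m\<in>\<beta>. z (Inl m) * m $$ x)" for x
    define Q where "Q x = (\<Sum>a<d. z (Inr a) * F a x)" for x
    have PQ: "P x + Q x = 0" if "x \<in> ?X" for x
      using z(2)[OF that] \<beta>(1) by (simp add: sum.Plus h_def P_def Q_def)
    have "(\<Sum>x\<in>?X. Q x * P x) = (\<Sum>x\<in>?X. \<Sum>m\<in>\<beta>. \<Sum>a<d. z (Inl m) * z (Inr a) * (F a x * m $$ x))"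
      unfolding P_def Q_def by (subst sum_product, subst sum.swap) (simp add: mult_ac)
    also have "\<dots> = (\<Sum>m\<in>\<beta>. \<Sum>a<d. z (Inl m) * z (Inr a) * (\<Sum>x\<in>?X. F a x * m $$ x))"
      unfolding sum_distrib_left by (subst sum.swap, rule sum.cong[OF refl], rule sum.swap)
    also have "\<dots> = 0" using orth\<beta> by simp
    finally have "(\<Sum>x\<in>?X. Q x * P x) = 0" .
    moreover have "(\<Sum>x\<in>?X. Q x * P x) = - (\<Sum>x\<in>?X. Q x * Q x)"
      unfolding sum_negf[symmetric]
    proof (rule sum.cong[OF refl])
      fix x assume "x \<in> ?X"
      then have "P x = - Q x" using PQ[of x] by simp
      then show "Q x * P x = - (Q x * Q x)" by simp
    qed
    ultimately have "(\<Sum>x\<in>?X. Q x * Q x) = 0" by simp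
    then have Q0: "\<forall>x\<in>?X. Q x = 0" by (subst (asm) sum_nonneg_eq_0_iff) auto
    then have zr: "\<forall>a\<in>{..<d}. z (Inr a) = 0"
      using indep[unfolded independent_on_def, rule_format, of "\<lambda>a. z (Inr a)"]
      unfolding Q_def by blast
    have P0: "P x = 0" if "x \<in> ?X" for x using PQ[OF that] Q0 that by simp
    have "V.lincomb (\<lambda>m. z (Inl m)) \<beta> = 0\<^sub>m N N"
    proof (rule eq_matI)
      fix i j assume "i < dim_row (0\<^sub>m N N :: real mat)" "j < dim_col (0\<^sub>m N N :: real mat)"
      then show "V.lincomb (\<lambda>m. z (Inl m)) \<beta> $$ (i, j) = 0\<^sub>m N N $$ (i, j)"
        using P0[of "(i, j)"] index_lincomb_mat[OF \<beta>(1) \<beta>V, of i j] by (simp add: P_def V_def)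
    next
      have "V.lincomb (\<lambda>m. z (Inl m)) \<beta> \<in> carrier_mat N N"
        using V.lincomb_closed[of \<beta> "\<lambda>m. z (Inl m)"] \<beta>V carrier by (auto simp: class_ring_simps)
      then show "dim_row (V.lincomb (\<lambda>m. z (Inl m)) \<beta>) = dim_row (0\<^sub>m N N :: real mat)"
        "dim_col (V.lincomb (\<lambda>m. z (Inl m)) \<beta>) = dim_col (0\<^sub>m N N :: real mat)" by auto
    qed
    then have zl: "\<forall>m\<in>\<beta>. z (Inl m) = 0"
      using li \<beta>(1) unfolding V.lin_dep_def
      by (auto simp: V_def module_mat_simps class_ring_simps)
    show False using z(1) zr zl by auto
  qed
  then show ?thesis using W.dim_basis[OF \<beta>] by simp
qed

text \<open>The entrywise inner product of \<open>B\<close> with the real (imaginary) part of the matrix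
  \<open>defect_mat U i j\<close> is the real (imaginary) part of \<open>\<Sum>\<^sub>c (B\<^sub>i\<^sub>c - B\<^sub>j\<^sub>c) U\<^sub>i\<^sub>c cnj U\<^sub>j\<^sub>c\<close>, so phase
  variations are orthogonal to the generators.\<close>

lemma generalized_defect_ge:
  assumes U: "U \<in> carrier_mat N N"
    and d: "defect_at_least {..<N} (\<lambda>i c. U $$ (i, c)) d"
  shows "int d \<le> generalized_defect U"
proof -
  obtain F where F: "\<And>a. a < d \<Longrightarrow> phase_variation {..<N} (\<lambda>i c. U $$ (i, c)) (F a)"
    and ind: "independent_on ({..<N} \<times> {..<N}) {..<d} (F :: nat \<Rightarrow> nat \<times> nat \<Rightarrow> real)"
    using d unfolding defect_at_least_def by auto
  let ?X = "{..<N} \<times> {..<N}"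
  have N: "dim_row U = N" using U by auto
  define G where "G = {defect_A U i j | i j. i < j \<and> j < dim_row U} \<union>
      {defect_S U i j | i j. i < j \<and> j < dim_row U}"
  have "G \<subseteq> (\<lambda>(i, j). defect_A U i j) ` ?X \<union> (\<lambda>(i, j). defect_S U i j) ` ?X"
    unfolding G_def N by force
  then have fin: "finite G" by (rule finite_subset) auto
  have car: "G \<subseteq> carrier_mat N N"
    by (auto simp: G_def defect_A_def defect_S_def defect_mat_def N)
  have row: "(\<Sum>x\<in>?X. F a x * f (defect_mat U i j $$ x))
       = f (\<Sum>c<N. of_real (F a (i, c) - F a (j, c)) * (U $$ (i, c) * cnj (U $$ (j, c))))"
    if ij: "i < j" "j < N" and f: "f = Re \<or> f = Im" for a i j f
  proof -
    have f0: "f 0 = 0" "\<And>r z. f (of_real r * z) = r * f z" "\<And>z. f (- z) = - f z"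
      "\<And>g. f (\<Sum>c<N. g c) = (\<Sum>c<N. f (g c))"
      using f by auto
    let ?e = "\<lambda>c. U $$ (i, c) * cnj (U $$ (j, c))"
    have "(\<Sum>x\<in>?X. F a x * f (defect_mat U i j $$ x))
        = (\<Sum>k<N. \<Sum>c<N. F a (k, c) * f (defect_mat U i j $$ (k, c)))"
      by (simp add: sum.cartesian_product case_prod_unfold)
    also have "\<dots> = (\<Sum>k<N. (if k = i then \<Sum>c<N. F a (i, c) * f (?e c) else 0)
        - (if k = j then \<Sum>c<N. F a (j, c) * f (?e c) else 0))"
      using ij by (intro sum.cong) (auto simp: defect_mat_def N f0 sum_negf)
    also have "\<dots> = (\<Sum>c<N. F a (i, c) * f (?e c)) - (\<Sum>c<N. F a (j, c) * f (?e c))"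
      using ij by (simp add: sum_subtractf)
    also have "\<dots> = f (\<Sum>c<N. of_real (F a (i, c) - F a (j, c)) * ?e c)"
      unfolding f0 sum_subtractf[symmetric] by (simp add: left_diff_distrib)
    finally show ?thesis .
  qed
  have orth: "(\<Sum>x\<in>?X. F a x * m $$ x) = 0" if a: "a < d" and m: "m \<in> G" for a m
  proof -
    obtain i j f where ij: "i < j" "j < N" and f: "f = Re \<or> f = Im"
      and m': "m = map_mat f (defect_mat U i j)"
      using m by (auto simp: G_def N defect_A_def defect_S_def)
    have "(\<Sum>x\<in>?X. F a x * m $$ x) = (\<Sum>x\<in>?X. F a x * f (defect_mat U i j $$ x))"
      by (intro sum.cong) (auto simp: m' defect_mat_def N)
    also have "\<dots> = f (\<Sum>c<N. of_real (F a (i, c) - F a (j, c)) * (U $$ (i, c) * cnj (U $$ (j, c))))"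
      by (rule row[OF ij f])
    also have "\<dots> = f 0"
      using F[OF a, unfolded phase_variation_def, rule_format, of i j] ij by simp
    also have "\<dots> = 0" using f by auto
    finally show ?thesis .
  qed
  have "vectorspace.dim class_ring (module_mat TYPE(real) N N\<lparr>carrier := defect_space U\<rparr>) + d \<le> N\<^sup>2"
    using dim_span_mat_le[OF fin car orth ind] unfolding defect_space_def G_def N .
  then show ?thesis unfolding generalized_defect_def N by linarith
qed

section \<open>Unitary matrices\<close>

lemma unitary_mat_row_orthogonal:
  assumes "unitary_mat n A" "i < n" "j < n"
  shows "(\<Sum>c<n. A $$ (i, c) * cnj (A $$ (j, c))) = (if i = j then 1 else 0)"
proof -
  have A: "A \<in> carrier_mat n n" "A * mat_adjoint A = 1\<^sub>m n" using assms by (auto simp: unitary_mat_def)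
  have "(A * mat_adjoint A) $$ (i, j) = (\<Sum>c<n. A $$ (i, c) * cnj (A $$ (j, c)))"
    using A(1) assms(2,3)
    by (auto simp: times_mat_def scalar_prod_def mat_adjoint_def mat_of_rows_def atLeast0LessThan
        intro!: sum.cong)
  then show ?thesis using A(2) assms by simp
qed

text \<open>Row phases and column phases may be changed freely: the variations \<open>B\<^sub>i\<^sub>c = a\<^sub>i + b\<^sub>c\<close>. The only
  redundancy is the constant matrix, which is both a sum of row variations and a sum of column
  variations, so the column variation of column \<open>0\<close> is left out.\<close>

lemma unitary_defect_at_least:
  assumes A: "unitary_mat n A" and n: "n \<ge> 1"
  shows "defect_at_least {..<n} (\<lambda>i c. A $$ (i, c)) (2 * n - 1)"
proof -
  define F :: "nat + nat \<Rightarrow> nat \<times> nat \<Rightarrow> real" where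
    "F q x = (case q of Inl k \<Rightarrow> of_bool (fst x = k) | Inr k \<Rightarrow> of_bool (snd x = k))" for q x
  let ?K = "{..<n} <+> {1..<n}"
  have card: "card ?K = 2 * n - 1" using n by (simp add: card_Plus)
  have "phase_variation {..<n} (\<lambda>i c. A $$ (i, c)) (F q)" if "q \<in> ?K" for q
    unfolding phase_variation_def
  proof (intro ballI)
    fix i j assume ij: "i \<in> {..<n}" "j \<in> {..<n}"
    show "(\<Sum>c<n. of_real (F q (i, c) - F q (j, c)) * (A $$ (i, c) * cnj (A $$ (j, c)))) = 0"
    proof (cases q)
      case (Inl k)
      have "(\<Sum>c<n. of_real (F q (i, c) - F q (j, c)) * (A $$ (i, c) * cnj (A $$ (j, c))))
          = (of_bool (i = k) - of_bool (j = k)) * (\<Sum>c<n. A $$ (i, c) * cnj (A $$ (j, c)))"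
        by (simp add: F_def Inl sum_distrib_left)
      then show ?thesis using unitary_mat_row_orthogonal[OF A, of i j] ij by auto
    next
      case (Inr k)
      then show ?thesis by (simp add: F_def)
    qed
  qed
  moreover have "independent_on ({..<n} \<times> {..<n}) ?K F"
    unfolding independent_on_def
  proof (intro allI impI)
    fix z assume z: "\<forall>x\<in>{..<n} \<times> {..<n}. (\<Sum>q\<in>?K. z q * F q x) = 0"
    have entry: "z (Inl i) + (if c = 0 then 0 else z (Inr c)) = 0" if "i < n" "c < n" for i c
    proof -
      have "(\<Sum>q\<in>?K. z q * F q (i, c))
          = (\<Sum>k<n. if k = i then z (Inl k) else 0) + (\<Sum>k\<in>{1..<n}. if k = c then z (Inr k) else 0)"
        by (subst sum.Plus) (auto simp: F_def intro!: arg_cong2[of _ _ _ _ "(+)"] sum.cong)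
      then show ?thesis using z that by auto
    qed
    have "z (Inl i) = 0" if "i < n" for i using entry[OF that, of 0] n by simp
    moreover from this have "z (Inr c) = 0" if "c \<in> {1..<n}" for c
      using entry[of 0 c] n that by simp
    ultimately show "\<forall>q\<in>?K. z q = 0" by auto
  qed
  ultimately show ?thesis
    by (intro defect_at_leastI[OF _ card]) auto
qed

text \<open>The common phase \<open>p\<close> may differ from one pair of rows to the next. What matters is that the terms
  of each single inner product of rows share it up to sign.\<close>

definition aligned_rows :: "'i set \<Rightarrow> ('i \<Rightarrow> 'i \<Rightarrow> complex) \<Rightarrow> bool" where
  "aligned_rows J t \<longleftrightarrow>
     (\<forall>i\<in>J. \<forall>j\<in>J. \<exists>p. \<forall>c\<in>J. \<exists>s::real. t i c * cnj (t j c) = p * of_real s)"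

text \<open>With aligned rows the complex equation for a pair of rows is a complex multiple of a single real
  one. There are \<open>k (k - 1) / 2\<close> unordered pairs of distinct rows, against \<open>k\<^sup>2\<close> unknowns.\<close>

lemma aligned_rows_defect_at_least:
  assumes fin: "finite J" and al: "aligned_rows J t"
  shows "defect_at_least J t (card J * (card J + 1) div 2)"
proof -
  let ?k = "card J" and ?X = "J \<times> J"
  define E where "E = (SIGMA b:{..<?k}. {..<b})"
  have "\<exists>p s. \<forall>c\<in>J. t i c * cnj (t j c) = p * of_real (s c)" if "i \<in> J" "j \<in> J" for i j
    using al that unfolding aligned_rows_def by metis
  then obtain p s where ps:
    "\<And>i j c. i \<in> J \<Longrightarrow> j \<in> J \<Longrightarrow> c \<in> J \<Longrightarrow> t i c * cnj (t j c) = p i j * of_real (s i j c)"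
    by metis
  obtain h where h: "bij_betw h {..<?k} J"
    using ex_bij_betw_nat_finite[OF fin] by (auto simp: atLeast0LessThan)
  have hJ: "h a \<in> J" if "a < ?k" for a using bij_betwE[OF h] that by auto
  \<comment> \<open>the coefficients of the real equation for the pair of rows \<open>h (snd e)\<close>, \<open>h (fst e)\<close>\<close>
  define g where "g e x = of_bool (fst x = h (snd e)) * s (h (snd e)) (h (fst e)) (snd x)
      - of_bool (fst x = h (fst e)) * s (h (snd e)) (h (fst e)) (snd x)"
    for e :: "nat \<times> nat" and x
  have "card E = (\<Sum>b<?k. b)" unfolding E_def by simp
  also have "\<dots> = ?k * (?k - 1) div 2"
    using Sum_Ico_nat[of 0 ?k] by (simp add: atLeast0LessThan)
  finally have "card E + ?k * (?k + 1) div 2 = ?k * (?k - 1) div 2 + ?k * (?k + 1) div 2" by simp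
  also have "\<dots> = (?k * (?k - 1) + ?k * (?k + 1)) div 2"
    by (rule div_plus_div_distrib_dvd_left[symmetric]) (cases ?k, auto)
  also have "?k * (?k - 1) + ?k * (?k + 1) = 2 * (?k * ?k)"
    by (cases ?k) (auto simp: algebra_simps)
  finally have cE: "card E + ?k * (?k + 1) div 2 \<le> card ?X"
    by (simp add: card_cartesian_product)
  have finE: "finite E" by (simp add: E_def)
  from solution_space_dimension[OF _ finE cE, of g] fin
  obtain F where
    F: "\<And>a e. a < ?k * (?k + 1) div 2 \<Longrightarrow> e \<in> E \<Longrightarrow> (\<Sum>x\<in>?X. F a x * g e x) = 0" and
    ind: "independent_on ?X {..<?k * (?k + 1) div 2} (F :: nat \<Rightarrow> 'a \<times> 'a \<Rightarrow> real)" by auto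
  have "phase_variation J t (F m)" if m: "m < ?k * (?k + 1) div 2" for m
  proof -
    let ?S = "\<lambda>i j. \<Sum>c\<in>J. of_real (F m (i, c) - F m (j, c)) * (t i c * cnj (t j c))"
    have up: "?S (h a) (h b) = 0" if ab: "a < b" "b < ?k" for a b
    proof -
      let ?i = "h a" and ?j = "h b"
      have J: "?i \<in> J" "?j \<in> J" using hJ ab by auto
      have "0 = (\<Sum>x\<in>?X. F m x * g (b, a) x)"
        using F[OF m, of "(b, a)"] ab by (auto simp: E_def)
      also have "\<dots> = (\<Sum>k\<in>J. \<Sum>c\<in>J. F m (k, c) * g (b, a) (k, c))"
        by (simp add: sum.cartesian_product case_prod_unfold)
      also have "\<dots> = (\<Sum>k\<in>J. (if k = ?i then \<Sum>c\<in>J. F m (?i, c) * s ?i ?j c else 0)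
          - (if k = ?j then \<Sum>c\<in>J. F m (?j, c) * s ?i ?j c else 0))"
        by (intro sum.cong) (auto simp: g_def sum_negf)
      also have "\<dots> = (\<Sum>c\<in>J. F m (?i, c) * s ?i ?j c) - (\<Sum>c\<in>J. F m (?j, c) * s ?i ?j c)"
        using J fin by (simp add: sum_subtractf)
      also have "\<dots> = (\<Sum>c\<in>J. (F m (?i, c) - F m (?j, c)) * s ?i ?j c)"
        by (simp add: sum_subtractf left_diff_distrib)
      finally have real: "(\<Sum>c\<in>J. (F m (?i, c) - F m (?j, c)) * s ?i ?j c) = 0" by simp
      have "?S ?i ?j = (\<Sum>c\<in>J. p ?i ?j * of_real ((F m (?i, c) - F m (?j, c)) * s ?i ?j c))"
        using ps[OF J] by (intro sum.cong) auto
      also have "\<dots> = p ?i ?j * of_real (\<Sum>c\<in>J. (F m (?i, c) - F m (?j, c)) * s ?i ?j c)"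
        by (simp only: sum_distrib_left[symmetric] of_real_sum)
      finally show ?thesis using real by simp
    qed
    \<comment> \<open>swapping the two rows conjugates and negates the left-hand side, so one order of each pair is enough\<close>
    have sym: "?S j i = - cnj (?S i j)" for i j
      unfolding cnj_sum sum_negf[symmetric] by (intro sum.cong) (auto simp: algebra_simps)
    have "?S (h a) (h b) = 0" if "a < ?k" "b < ?k" for a b
    proof (cases a b rule: linorder_cases)
      case less then show ?thesis using up that by blast
    next
      case equal then show ?thesis by simp
    next
      case greater
      have "?S (h a) (h b) = - cnj (?S (h b) (h a))" by (rule sym)
      also have "?S (h b) (h a) = 0" using up greater that by blast
      finally show ?thesis by simp
    qed
    note all = this
    show ?thesis unfolding phase_variation_def
    proof (intro ballI)
      fix i j assume "i \<in> J" "j \<in> J"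
      then have "i \<in> h ` {..<?k}" "j \<in> h ` {..<?k}" using h by (auto simp: bij_betw_def)
      then obtain a b where "a < ?k" "b < ?k" "i = h a" "j = h b" by blast
      then show "?S i j = 0" using all by blast
    qed
  qed
  with ind show ?thesis
    unfolding defect_at_least_def by (intro exI[of _ F] conjI) auto
qed

section \<open>Kronecker products in multi-index form\<close>

text \<open>The rows of a Kronecker product as lists of rows of the factors. Unlike the numeric index
  obtained from \<open>div\<close> and \<open>mod\<close>, this makes permuting and regrouping the factors harmless.\<close>

primrec multi_indices :: "complex mat list \<Rightarrow> nat list set" where
  "multi_indices [] = {[]}"
| "multi_indices (A # As) = (\<lambda>(a, xs). a # xs) ` ({..<dim_row A} \<times> multi_indices As)"

primrec multi_entry :: "complex mat list \<Rightarrow> nat list \<Rightarrow> nat list \<Rightarrow> complex" where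
  "multi_entry [] p q = 1"
| "multi_entry (A # As) p q = A $$ (hd p, hd q) * multi_entry As (tl p) (tl q)"

lemma finite_multi_indices: "finite (multi_indices As)"
  by (induction As) auto

lemma card_multi_indices: "card (multi_indices As) = prod_list (map dim_row As)"
  by (induction As) (auto simp: card_image inj_on_def card_cartesian_product)

lemma bij_betw_Cons_multi_indices:
  "bij_betw (\<lambda>xs. (hd xs, tl xs)) (multi_indices (A # As)) ({..<dim_row A} \<times> multi_indices As)"
  by (rule bij_betw_byWitness[where f' = "\<lambda>(a, xs). a # xs"]) auto

lemma multi_entry_defect_at_least:
  assumes "\<And>A. A \<in> set As \<Longrightarrow> unitary_mat (dim_row A) A \<and> dim_row A \<ge> 1"
  shows "defect_at_least (multi_indices As) (multi_entry As)
           (prod_list (map (\<lambda>A. 2 * dim_row A - 1) As))"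
  using assms
proof (induction As)
  case Nil
  show ?case
    by (auto simp: defect_at_least_def phase_variation_def independent_on_def
        intro!: exI[of _ "\<lambda>_ _. 1"])
next
  case (Cons A As)
  have "defect_at_least ({..<dim_row A} \<times> multi_indices As)
      (\<lambda>p q. A $$ (fst p, fst q) * multi_entry As (snd p) (snd q))
      ((2 * dim_row A - 1) * prod_list (map (\<lambda>A. 2 * dim_row A - 1) As))"
    using Cons by (intro defect_at_least_tensor unitary_defect_at_least)
      (auto simp: finite_multi_indices)
  then show ?case
    by (intro defect_at_least_reindex[OF bij_betw_Cons_multi_indices]) auto
qed

text \<open>Distinct rows of a unitary matrix of size 2 are orthogonal, so the two terms of their inner
  product are opposite. For equal rows the terms are real.\<close>

lemma unitary_two_aligned_rows:
  assumes A: "unitary_mat 2 A"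
  shows "aligned_rows {..<2} (\<lambda>i c. A $$ (i, c))"
  unfolding aligned_rows_def
proof (intro ballI)
  fix i j :: nat assume ij: "i \<in> {..<2}" "j \<in> {..<2}"
  let ?e = "\<lambda>c. A $$ (i, c) * cnj (A $$ (j, c))"
  show "\<exists>p. \<forall>c\<in>{..<2}. \<exists>s::real. ?e c = p * of_real s"
  proof (cases "i = j")
    case True
    then have "\<forall>c\<in>{..<2}. ?e c = 1 * of_real ((cmod (A $$ (i, c)))\<^sup>2)"
      by (auto simp: complex_norm_square[symmetric])
    then show ?thesis by blast
  next
    case False
    then have "?e 0 + ?e 1 = 0"
      using unitary_mat_row_orthogonal[OF A, of i j] ij by (simp add: numeral_2_eq_2)
    then have "?e 1 = ?e 0 * of_real (- 1)" by (simp add: eq_neg_iff_add_eq_0 add.commute)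
    moreover have "?e 0 = ?e 0 * of_real 1" by simp
    ultimately show ?thesis
      by (intro exI[of _ "?e 0"]) (metis less_2_cases lessThan_iff One_nat_def)
  qed
qed

lemma multi_entry_aligned_rows:
  assumes "\<And>A. A \<in> set As \<Longrightarrow> dim_row A = 2 \<and> unitary_mat 2 A"
  shows "aligned_rows (multi_indices As) (multi_entry As)"
  using assms
proof (induction As)
  case Nil
  show ?case by (auto simp: aligned_rows_def intro!: exI[of _ 1])
next
  case (Cons A As)
  have A: "aligned_rows {..<2} (\<lambda>i c. A $$ (i, c))" and dim: "dim_row A = 2"
    using Cons.prems by (auto intro: unitary_two_aligned_rows)
  have IH: "aligned_rows (multi_indices As) (multi_entry As)" using Cons by auto
  show ?case unfolding aligned_rows_def
  proof (intro ballI)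
    fix i j assume "i \<in> multi_indices (A # As)" "j \<in> multi_indices (A # As)"
    then obtain i0 i1 j0 j1 where ij: "i = i0 # i1" "j = j0 # j1" "i0 \<in> {..<2}" "j0 \<in> {..<2}"
      "i1 \<in> multi_indices As" "j1 \<in> multi_indices As" using dim by auto
    obtain p where p: "\<And>c. c \<in> {..<2} \<Longrightarrow> \<exists>s::real. A $$ (i0, c) * cnj (A $$ (j0, c)) = p * of_real s"
      using A ij unfolding aligned_rows_def by meson
    obtain p' where p': "\<And>c. c \<in> multi_indices As \<Longrightarrow>
        \<exists>s::real. multi_entry As i1 c * cnj (multi_entry As j1 c) = p' * of_real s"
      using IH ij unfolding aligned_rows_def by meson
    have "\<exists>s::real. multi_entry (A # As) i c * cnj (multi_entry (A # As) j c) = (p * p') * of_real s"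
      if c: "c \<in> multi_indices (A # As)" for c
    proof -
      obtain c0 cs where c': "c = c0 # cs" "c0 \<in> {..<2}" "cs \<in> multi_indices As"
        using c dim by auto
      obtain s where s: "A $$ (i0, c0) * cnj (A $$ (j0, c0)) = p * of_real s"
        using p[OF c'(2)] by blast
      obtain s' where s': "multi_entry As i1 cs * cnj (multi_entry As j1 cs) = p' * of_real s'"
        using p'[OF c'(3)] by blast
      have "multi_entry (A # As) i c * cnj (multi_entry (A # As) j c)
          = (A $$ (i0, c0) * cnj (A $$ (j0, c0))) * (multi_entry As i1 cs * cnj (multi_entry As j1 cs))"
        by (simp add: ij c')
      also have "\<dots> = (p * p') * of_real (s * s')" unfolding s s' by simp
      finally show ?thesis by blast
    qed
    then show "\<exists>p. \<forall>c\<in>multi_indices (A # As). \<exists>s::real.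
        multi_entry (A # As) i c * cnj (multi_entry (A # As) j c) = p * of_real s" by blast
  qed
qed

lemma kronecker_list_carrier:
  assumes "\<And>A. A \<in> set As \<Longrightarrow> dim_col A = dim_row A"
  shows "kronecker_list As \<in> carrier_mat (prod_list (map dim_row As)) (prod_list (map dim_row As))"
  using assms by (induction As) (auto simp: kronecker_list_def kronecker_def)

text \<open>The defect is invariant under simultaneous relabelling of rows and columns, so this lets
  the factors of a Kronecker product be sorted by a predicate \<open>P\<close>.\<close>

lemma kronecker_list_regroup:
  assumes "\<And>A. A \<in> set As \<Longrightarrow> dim_col A = dim_row A \<and> dim_row A > 0"
  shows "\<exists>h. bij_betw h {..<prod_list (map dim_row As)}
        (multi_indices (filter P As) \<times> multi_indices (filter (\<lambda>A. \<not> P A) As)) \<and>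
      (\<forall>i<prod_list (map dim_row As). \<forall>c<prod_list (map dim_row As).
        kronecker_list As $$ (i, c) = multi_entry (filter P As) (fst (h i)) (fst (h c))
          * multi_entry (filter (\<lambda>A. \<not> P A) As) (snd (h i)) (snd (h c)))"
  using assms
proof (induction As)
  case Nil
  show ?case
    by (intro exI[of _ "\<lambda>_. ([], [])"]) (auto simp: kronecker_list_def bij_betw_def inj_on_def)
next
  case (Cons A As)
  define m where "m = prod_list (map dim_row As)"
  let ?a = "dim_row A" and ?Q = "\<lambda>A. \<not> P A"
  have "0 \<notin> set (map dim_row As)" using Cons.prems by force
  then have m: "m > 0" unfolding m_def by (metis prod_list_zero_iff gr0I)
  have car: "kronecker_list As \<in> carrier_mat m m"
    unfolding m_def using Cons.prems by (intro kronecker_list_carrier) auto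
  obtain h where h: "bij_betw h {..<m} (multi_indices (filter P As) \<times> multi_indices (filter ?Q As))"
    and entry: "\<And>i c. i < m \<Longrightarrow> c < m \<Longrightarrow>
        kronecker_list As $$ (i, c) = multi_entry (filter P As) (fst (h i)) (fst (h c))
          * multi_entry (filter ?Q As) (snd (h i)) (snd (h c))"
    using Cons unfolding m_def by auto
  \<comment> \<open>the leading digit \<open>k div m\<close> is prepended to the list of the group to which \<open>A\<close> belongs\<close>
  define g where "g k = (let (p, q) = h (k mod m) in
      if P A then ((k div m) # p, q) else (p, (k div m) # q))" for k
  have dm: "k div m < ?a" "k mod m < m" if "k < ?a * m" for k
    using that m by (auto simp: less_mult_imp_div_less)
  have hin: "h k \<in> multi_indices (filter P As) \<times> multi_indices (filter ?Q As)" if "k < m" for k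
    using bij_betwE[OF h] that by auto
  have "bij_betw g {..<?a * m} (multi_indices (filter P (A # As)) \<times> multi_indices (filter ?Q (A # As)))"
  proof (rule bij_betwI')
    fix x y assume xy: "x \<in> {..<?a * m}" "y \<in> {..<?a * m}"
    show "(g x = g y) = (x = y)"
    proof
      assume "g x = g y"
      then have "x div m = y div m" "h (x mod m) = h (y mod m)"
        by (auto simp: g_def split: prod.splits if_splits)
      moreover from this(2) have "x mod m = y mod m"
        using h m by (auto simp: bij_betw_def inj_on_def)
      ultimately show "x = y" by (metis div_mult_mod_eq)
    qed simp
  next
    fix x assume x: "x \<in> {..<?a * m}"
    then show "g x \<in> multi_indices (filter P (A # As)) \<times> multi_indices (filter ?Q (A # As))"
      using hin[of "x mod m"] dm[of x] by (auto simp: g_def split: prod.splits)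
  next
    fix y assume "y \<in> multi_indices (filter P (A # As)) \<times> multi_indices (filter ?Q (A # As))"
    then obtain a p q where a: "a < ?a" "p \<in> multi_indices (filter P As)"
      "q \<in> multi_indices (filter ?Q As)" "y = (if P A then (a # p, q) else (p, a # q))"
      by (cases "P A") auto
    then have "(p, q) \<in> h ` {..<m}" using h by (auto simp: bij_betw_def)
    then obtain k where k: "k < m" "h k = (p, q)" by auto
    have "a * m + k < Suc a * m" using k by simp
    also have "\<dots> \<le> ?a * m" using a by (intro mult_le_mono1) auto
    finally have "a * m + k \<in> {..<?a * m}" by simp
    moreover have "y = g (a * m + k)" using k a m by (simp add: g_def)
    ultimately show "\<exists>x\<in>{..<?a * m}. y = g x" by blast
  qed
  moreover have "kronecker_list (A # As) $$ (i, c)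
      = multi_entry (filter P (A # As)) (fst (g i)) (fst (g c))
        * multi_entry (filter ?Q (A # As)) (snd (g i)) (snd (g c))"
    if "i < ?a * m" "c < ?a * m" for i c
  proof -
    have "kronecker_list (A # As) = kronecker A (kronecker_list As)" by (simp add: kronecker_list_def)
    then have "kronecker_list (A # As) $$ (i, c)
        = A $$ (i div m, c div m) * kronecker_list As $$ (i mod m, c mod m)"
      using that car Cons.prems[of A] by (auto simp: kronecker_def)
    then show ?thesis using entry[OF dm(2)[OF that(1)] dm(2)[OF that(2)]]
      by (auto simp: g_def split: prod.splits)
  qed
  ultimately show ?case unfolding m_def by (intro exI[of _ g]) simp
qed

lemma kronecker_list_defect_ge:
  assumes "\<And>A. A \<in> set As \<Longrightarrow> unitary_mat (dim_row A) A \<and> dim_row A > 0"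
  shows "int (prod_list (map (\<lambda>A. 2 * dim_row A - 1) (filter (\<lambda>A. dim_row A \<noteq> 2) As))
           * (2 ^ length (filter (\<lambda>A. dim_row A = 2) As)
              * (2 ^ length (filter (\<lambda>A. dim_row A = 2) As) + 1) div 2))
         \<le> generalized_defect (kronecker_list As)"
proof -
  let ?B = "filter (\<lambda>A. dim_row A \<noteq> 2) As" and ?T = "filter (\<lambda>A. \<not> dim_row A \<noteq> 2) As"
  have sq: "dim_col A = dim_row A \<and> dim_row A > 0" if "A \<in> set As" for A
    using assms[OF that] by (auto simp: unitary_mat_def)
  obtain h where h: "bij_betw h {..<prod_list (map dim_row As)} (multi_indices ?B \<times> multi_indices ?T)"
    and entry: "\<And>i c. i < prod_list (map dim_row As) \<Longrightarrow> c < prod_list (map dim_row As) \<Longrightarrow>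
        kronecker_list As $$ (i, c) = multi_entry ?B (fst (h i)) (fst (h c))
          * multi_entry ?T (snd (h i)) (snd (h c))"
    using kronecker_list_regroup[of As "\<lambda>A. dim_row A \<noteq> 2"] sq by blast
  have "map dim_row ?T = replicate (length ?T) 2" by (induction As) auto
  then have card: "card (multi_indices ?T) = 2 ^ length ?T"
    by (simp add: card_multi_indices)
  have "defect_at_least (multi_indices ?B) (multi_entry ?B)
      (prod_list (map (\<lambda>A. 2 * dim_row A - 1) ?B))"
    using assms by (intro multi_entry_defect_at_least) (auto simp: Suc_le_eq)
  moreover have "aligned_rows (multi_indices ?T) (multi_entry ?T)"
    using assms by (intro multi_entry_aligned_rows) (auto, metis)
  then have "defect_at_least (multi_indices ?T) (multi_entry ?T) (2 ^ length ?T * (2 ^ length ?T + 1) div 2)"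
    using aligned_rows_defect_at_least[OF finite_multi_indices] card by metis
  ultimately have "defect_at_least (multi_indices ?B \<times> multi_indices ?T)
      (\<lambda>p q. multi_entry ?B (fst p) (fst q) * multi_entry ?T (snd p) (snd q))
      (prod_list (map (\<lambda>A. 2 * dim_row A - 1) ?B) * (2 ^ length ?T * (2 ^ length ?T + 1) div 2))"
    by (intro defect_at_least_tensor finite_multi_indices)
  then have "defect_at_least {..<prod_list (map dim_row As)} (\<lambda>i c. kronecker_list As $$ (i, c))
      (prod_list (map (\<lambda>A. 2 * dim_row A - 1) ?B) * (2 ^ length ?T * (2 ^ length ?T + 1) div 2))"
    by (intro defect_at_least_reindex[OF h]) (auto simp: entry)
  from generalized_defect_ge[OF kronecker_list_carrier this] sq show ?thesis by simp
qed

section \<open>The closed form of the bound\<close>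

text \<open>Both summands on the right are multiplicative in \<open>S\<close>. The convention \<open>\<sharp>\<^sub>2 = 1\<close> for
  sets without a 2 is what makes the second summand equal to 1 there.\<close>

lemma twice_power_sharp2:
  assumes "finite S"
  shows "2 * 2 ^ (sharp2 n S - 1) = (2::int) ^ card {l \<in> S. n l = 2} + of_bool (\<forall>l\<in>S. n l \<noteq> 2)"
proof (cases "\<exists>l\<in>S. n l = 2")
  case True
  then have "card {l \<in> S. n l = 2} > 0" using assms by (auto simp: card_gt_0_iff)
  moreover have "sharp2 n S = card {l \<in> S. n l = 2}" using True by (simp add: sharp2_def)
  ultimately show ?thesis using True by (cases "card {l \<in> S. n l = 2}") auto
next
  case False
  then have "{l \<in> S. n l = 2} = {}" by auto
  then show ?thesis using False by (auto simp: sharp2_def simp del: Collect_empty_eq)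
qed

text \<open>A product of factors \<open>f l + g l\<close> expands into a sum over the sets \<open>K\<close> of indices \<open>l\<close> for which
  \<open>f l\<close> is taken; here the sums are read backwards. The terms without the power of 2 add up to \<open>\<Prod> (n\<^sub>l + n\<^sub>l (n\<^sub>l - 1)) = \<Prod> n\<^sub>l\<^sup>2\<close> and cancel the leading square.
  In the two products that remain, every \<open>l\<close> with \<open>n\<^sub>l \<noteq> 2\<close> contributes \<open>2 n\<^sub>l - 1\<close>, and one with
  \<open>n\<^sub>l = 2\<close> contributes \<open>4\<close> and \<open>2\<close>, respectively.\<close>

lemma twice_defect_lower_bound:
  fixes n :: "nat \<Rightarrow> nat"
  assumes r: "r \<ge> 1"
  defines "x \<equiv> card {l \<in> {1..r}. n l = 2}"
  shows "2 * defect_lower_bound r n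
    = (\<Prod>l\<in>{l \<in> {1..r}. n l \<noteq> 2}. 2 * int (n l) - 1) * (2 ^ x * (2 ^ x + 1))"
proof -
  let ?T = "{1..r}" and ?n = "\<lambda>l. int (n l)"
  let ?w = "\<lambda>S. (2::int) ^ (sharp2 n S - 1)"
  let ?t = "\<lambda>K. (\<Prod>k\<in>K. ?n k) * ((\<Prod>l\<in>?T - K. ?n l) - ?w (?T - K)) * (\<Prod>l\<in>?T - K. ?n l - 1)"
  have powers: "(\<Prod>l\<in>?T. if n l = 2 then a else 2 * ?n l - 1)
      = a ^ x * (\<Prod>l\<in>{l \<in> ?T. n l \<noteq> 2}. 2 * ?n l - 1)" for a :: int
  proof -
    have "?T \<inter> {l. n l = 2} = {l \<in> ?T. n l = 2}" "?T \<inter> - {l. n l = 2} = {l \<in> ?T. n l \<noteq> 2}" by auto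
    then show ?thesis by (simp add: prod.If_cases x_def)
  qed
  have split: "(\<Prod>l\<in>?T. f l + g l) = (\<Sum>K\<in>Pow ?T. (\<Prod>l\<in>K. f l) * (\<Prod>l\<in>?T - K. g l))"
    for f g :: "nat \<Rightarrow> int" by (rule prod_add) simp
  have "(\<Sum>p\<in>{0..r - 1}. \<Sum>K\<in>{K. K \<subseteq> ?T \<and> card K = p}. ?t K)
      = (\<Sum>K\<in>(\<Union>p\<in>{0..r - 1}. {K. K \<subseteq> ?T \<and> card K = p}). ?t K)"
    by (rule sum.UNION_disjoint[symmetric]) auto
  also have "(\<Union>p\<in>{0..r - 1}. {K. K \<subseteq> ?T \<and> card K = p}) = Pow ?T - {?T}"
  proof -
    have proper: "card K \<le> r - 1 \<longleftrightarrow> K \<noteq> ?T" if "K \<subseteq> ?T" for K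
      using psubset_card_mono[of ?T K] that r by (cases "K = ?T") (auto simp: psubset_eq)
    have "(\<Union>p\<in>{0..r - 1}. {K. K \<subseteq> ?T \<and> card K = p}) = {K. K \<subseteq> ?T \<and> card K \<le> r - 1}"
      by auto
    then show ?thesis using proper by blast
  qed
  \<comment> \<open>the term for the full set is zero because \<open>sharp2\<close> of the empty set is 1\<close>
  also have "(\<Sum>K\<in>Pow ?T - {?T}. ?t K) = (\<Sum>K\<in>Pow ?T. ?t K)"
    by (rule sum.mono_neutral_left) (auto simp: sharp2_def)
  also have "\<dots> = (\<Sum>K\<in>Pow ?T. (\<Prod>l\<in>K. ?n l) * (\<Prod>l\<in>?T - K. ?n l * (?n l - 1)))
      - (\<Sum>K\<in>Pow ?T. (\<Prod>l\<in>K. ?n l) * ?w (?T - K) * (\<Prod>l\<in>?T - K. ?n l - 1))"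
    unfolding sum_subtractf[symmetric] prod.distrib by (simp add: algebra_simps)
  also have "(\<Sum>K\<in>Pow ?T. (\<Prod>l\<in>K. ?n l) * (\<Prod>l\<in>?T - K. ?n l * (?n l - 1))) = (\<Prod>l\<in>?T. ?n l)\<^sup>2"
    unfolding split[symmetric] prod_power_distrib
    by (rule prod.cong) (auto simp: algebra_simps power2_eq_square)
  finally have "defect_lower_bound r n
      = (\<Sum>K\<in>Pow ?T. (\<Prod>l\<in>K. ?n l) * ?w (?T - K) * (\<Prod>l\<in>?T - K. ?n l - 1))"
    unfolding defect_lower_bound_def by simp
  then have "2 * defect_lower_bound r n
      = (\<Sum>K\<in>Pow ?T. (\<Prod>l\<in>K. ?n l) * (2 * ?w (?T - K)) * (\<Prod>l\<in>?T - K. ?n l - 1))"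
    by (simp add: sum_distrib_left algebra_simps)
  also have "\<dots> = (\<Sum>K\<in>Pow ?T. (\<Prod>l\<in>K. ?n l) * (\<Prod>l\<in>?T - K. (if n l = 2 then 2 else 1) * (?n l - 1)))
      + (\<Sum>K\<in>Pow ?T. (\<Prod>l\<in>K. ?n l) * (\<Prod>l\<in>?T - K. of_bool (n l \<noteq> 2) * (?n l - 1)))"
    unfolding sum.distrib[symmetric]
  proof (rule sum.cong[OF refl])
    fix K assume "K \<in> Pow ?T"
    let ?S = "?T - K"
    have "?S \<inter> {l. n l = 2} = {l \<in> ?S. n l = 2}" by auto
    then have doubled: "(\<Prod>l\<in>?S. if n l = 2 then 2 else 1) = (2::int) ^ card {l \<in> ?S. n l = 2}"
      by (simp add: prod.If_cases)
    have vanishing: "(\<Prod>l\<in>?S. of_bool (n l \<noteq> 2)) = (of_bool (\<forall>l\<in>?S. n l \<noteq> 2) :: int)"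
      by (auto simp: prod_zero_iff)
    have fin: "finite ?S" by simp
    show "(\<Prod>l\<in>K. ?n l) * (2 * ?w ?S) * (\<Prod>l\<in>?S. ?n l - 1)
        = (\<Prod>l\<in>K. ?n l) * (\<Prod>l\<in>?S. (if n l = 2 then 2 else 1) * (?n l - 1))
        + (\<Prod>l\<in>K. ?n l) * (\<Prod>l\<in>?S. of_bool (n l \<noteq> 2) * (?n l - 1))"
      unfolding prod.distrib doubled vanishing twice_power_sharp2[OF fin]
      by (simp only: ring_distribs mult_ac)
  qed
  also have "\<dots> = (\<Prod>l\<in>?T. ?n l + (if n l = 2 then 2 else 1) * (?n l - 1))
      + (\<Prod>l\<in>?T. ?n l + of_bool (n l \<noteq> 2) * (?n l - 1))"
    unfolding split ..
  also have "(\<Prod>l\<in>?T. ?n l + (if n l = 2 then 2 else 1) * (?n l - 1))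
      = (\<Prod>l\<in>?T. if n l = 2 then 4 else 2 * ?n l - 1)"
    by (rule prod.cong) auto
  also have "(\<Prod>l\<in>?T. ?n l + of_bool (n l \<noteq> 2) * (?n l - 1))
      = (\<Prod>l\<in>?T. if n l = 2 then 2 else 2 * ?n l - 1)"
    by (rule prod.cong) auto
  finally have "2 * defect_lower_bound r n
      = (\<Prod>l\<in>{l \<in> ?T. n l \<noteq> 2}. 2 * ?n l - 1) * (4 ^ x + 2 ^ x)"
    unfolding powers by (simp only: ring_distribs mult_ac)
  also have "(4::int) ^ x + 2 ^ x = 2 ^ x * (2 ^ x + 1)"
    using power_mult_distrib[of "2::int" 2 x] by (simp add: algebra_simps)
  finally show ?thesis .
qed

theorem theorem3p4:
  fixes r :: nat and n :: "nat \<Rightarrow> nat" and U :: "nat \<Rightarrow> complex mat"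
  assumes "r \<ge> 1"
    and "\<And>k. k \<in> {1..r} \<Longrightarrow> n k > 1"
    and "\<And>k. k \<in> {1..r} \<Longrightarrow> unitary_mat (n k) (U k)"
  shows "generalized_defect (kronecker_list (map U [1..<Suc r])) \<ge> defect_lower_bound r n
    \<and> ((\<forall>k\<in>{1..r}. n k > 2) \<longrightarrow>
         defect_lower_bound r n = (\<Prod>l\<in>{1..r}. (2 * int (n l) - 1)))
    \<and> ((\<exists>k\<in>{1..r}. n k = 2) \<longrightarrow>
         defect_lower_bound r n =
           (\<Prod>l\<in>{l \<in> {1..r}. n l > 2}. (2 * int (n l) - 1)) *
           (2 ^ (sharp2 n {1..r} - 1) * (2 ^ sharp2 n {1..r} + 1)))"
proof -
  define x where "x = card {l \<in> {1..r}. n l = 2}"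
  define Q where "Q = (\<Prod>l\<in>{l \<in> {1..r}. n l \<noteq> 2}. 2 * int (n l) - 1)"
  have L: "2 * defect_lower_bound r n = Q * (2 ^ x * (2 ^ x + 1))"
    unfolding Q_def x_def by (rule twice_defect_lower_bound[OF assms(1)])
  have gt2: "{l \<in> {1..r}. n l \<noteq> 2} = {l \<in> {1..r}. n l > 2}"
    using assms(2) by (force simp: le_less Suc_le_eq)
  define As where "As = map U [1..<Suc r]"
  have dim: "dim_row (U l) = n l" if "l \<in> {1..r}" for l
    using assms(3)[OF that] by (auto simp: unitary_mat_def)
  have "filter (\<lambda>A. dim_row A = 2) As = map U (filter (\<lambda>l. n l = 2) [1..<Suc r])"
    unfolding As_def filter_map by (auto simp: dim intro!: arg_cong[of _ _ "map U"] filter_cong)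
  then have twos: "length (filter (\<lambda>A. dim_row A = 2) As) = x"
    using distinct_card[of "filter (\<lambda>l. n l = 2) [1..<Suc r]"]
    by (simp add: x_def atLeastLessThanSuc_atLeastAtMost del: upt_Suc)
  have "filter (\<lambda>A. dim_row A \<noteq> 2) As = map U (filter (\<lambda>l. n l \<noteq> 2) [1..<Suc r])"
    unfolding As_def filter_map by (auto simp: dim intro!: arg_cong[of _ _ "map U"] filter_cong)
  then have "prod_list (map (\<lambda>A. 2 * dim_row A - 1) (filter (\<lambda>A. dim_row A \<noteq> 2) As))
      = prod_list (map (\<lambda>l. 2 * dim_row (U l) - 1) (filter (\<lambda>l. n l \<noteq> 2) [1..<Suc r]))"
    by (simp add: o_def del: upt_Suc)
  also have "\<dots> = (\<Prod>l\<in>set (filter (\<lambda>l. n l \<noteq> 2) [1..<Suc r]). 2 * dim_row (U l) - 1)"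
    by (rule prod.distinct_set_conv_list[symmetric]) simp
  also have "\<dots> = (\<Prod>l\<in>{l \<in> {1..r}. n l \<noteq> 2}. 2 * n l - 1)"
    using dim by (intro prod.cong) auto
  also have "int \<dots> = Q"
    unfolding Q_def of_nat_prod using assms(2) by (intro prod.cong) (force simp: of_nat_diff)+
  finally have others: "int (prod_list (map (\<lambda>A. 2 * dim_row A - 1) (filter (\<lambda>A. dim_row A \<noteq> 2) As))) = Q" .
  have "unitary_mat (dim_row A) A \<and> dim_row A > 0" if A: "A \<in> set As" for A
  proof -
    have "A \<in> U ` {1..r}"
      using A by (simp add: As_def atLeastLessThanSuc_atLeastAtMost del: upt_Suc)
    then obtain l where "l \<in> {1..r}" "A = U l" by blast
    then show ?thesis using dim assms(2,3)[of l] by auto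
  qed
  then have "int (prod_list (map (\<lambda>A. 2 * dim_row A - 1) (filter (\<lambda>A. dim_row A \<noteq> 2) As))) *
      int (2 ^ x * (2 ^ x + 1) div 2) \<le> generalized_defect (kronecker_list As)"
    using kronecker_list_defect_ge[of As] unfolding twos of_nat_mult by blast
  then have "Q * (2 ^ x * (2 ^ x + 1) div 2) \<le> generalized_defect (kronecker_list As)"
    unfolding others by (simp add: zdiv_int algebra_simps)
  moreover have half: "2 * ((2::int) ^ x * (2 ^ x + 1) div 2) = 2 ^ x * (2 ^ x + 1)"
    by (rule dvd_mult_div_cancel) (cases x, auto)
  have "2 * defect_lower_bound r n = 2 * (Q * (2 ^ x * (2 ^ x + 1) div 2))"
    unfolding mult.left_commute[of 2 Q] half by (rule L)
  then have "defect_lower_bound r n = Q * (2 ^ x * (2 ^ x + 1) div 2)" by simp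
  ultimately have bound: "defect_lower_bound r n \<le> generalized_defect (kronecker_list As)" by simp
  moreover have "defect_lower_bound r n = (\<Prod>l\<in>{1..r}. (2 * int (n l) - 1))"
    if "\<forall>k\<in>{1..r}. n k > 2"
  proof -
    have none: "{l \<in> {1..r}. n l = 2} = {}" and all: "{l \<in> {1..r}. n l \<noteq> 2} = {1..r}"
      using that by force+
    show ?thesis using L unfolding x_def Q_def none all by simp
  qed
  moreover have "defect_lower_bound r n = (\<Prod>l\<in>{l \<in> {1..r}. n l > 2}. (2 * int (n l) - 1)) *
      (2 ^ (sharp2 n {1..r} - 1) * (2 ^ sharp2 n {1..r} + 1))" if "\<exists>k\<in>{1..r}. n k = 2"
  proof -
    have "sharp2 n {1..r} = x" using that by (simp add: sharp2_def x_def)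
    moreover have "x > 0" using that by (auto simp: x_def card_gt_0_iff)
    then have "(2::int) ^ x = 2 * 2 ^ (x - 1)" by (cases x) auto
    then have "2 * defect_lower_bound r n = 2 * (Q * (2 ^ (x - 1) * (2 ^ x + 1)))"
      unfolding L by (simp only: mult_ac)
    ultimately show ?thesis unfolding Q_def gt2 by simp
  qed
  ultimately show ?thesis unfolding As_def by blast
qed

end
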